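(* Let $f,g\in C_F^{\alpha n}[a,b]$, $b>a$, and let ${}^N_aD_F^\gamma$ be the fractal time derivative of order $\gamma\in[n-1,n)$ defined by $${}^N_aD_F^\gamma f(S_F^\alpha(t))=\frac{1}{\Gamma_F^\alpha(n-\gamma)}\int_{S_F^\alpha(0)}^{S_F^\alpha(t)}\frac{(D_{F,\tau}^\alpha)^n f(S_F^\alpha(\tau))}{\left(S_F^\alpha(t)-S_F^\alpha(\tau)\right)^{\gamma}}\,d_F^\alpha\tau .$$ Then ${}^N_aD_F^\gamma$ is a linear operator, that is, for any $l_1,l_2\in\mathbb R$, $${}^N_aD_F^\gamma\bigl(l_1f(S_F^\alpha(t))+l_2g(S_F^\alpha(t))\bigr)=l_1\,{}^N_aD_F^\gamma f(S_F^\alpha(t))+l_2\,{}^N_aD_F^\gamma g(S_F^\alpha(t)).$$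
   Context: Let $0<\alpha\le1$ and let $F$ be a fractal subset of the real line. For a subdivision $\mathbb P=\{x=x_0,x_1,\dots,x_m=y\}$ of $[x,y]$, $x<y$, put $\sigma^\alpha[F,\mathbb P]=\sum_{i=0}^{m-1}\frac{(x_{i+1}-x_i)^\alpha}{\Gamma(\alpha+1)}\Theta(F,[x_i,x_{i+1}])$, where $\Theta(F,I)=1$ if $F\cap I\ne\emptyset$ and $0$ otherwise (and $\sigma^\alpha=0$ if $x=y$). Put $\gamma^\alpha(F,x,y)=\lim_{\delta\to0}\inf\sigma^\alpha[F,\mathbb P]$, the infimum being over subdivisions of $[x,y]$ of mesh at most $\delta$. For a fixed arbitrary real $l$, the integral staircase function is $S_F^\alpha(x)=\gamma^\alpha(F,l,x)$ if $x\ge l$ and $-\gamma^\alpha(F,x,l)$ otherwise. $D_F^\alpha$ and $\int\cdot\,d_F^\alpha$ are the derivative and integral of $F^\alpha$-calculus: for $x\in F$, $D_F^\alpha h(x)$ is the limit, along points $y\in F$, $y\to x$, of $\frac{h(y)-h(x)}{S_F^\alpha(y)-S_F^\alpha(x)}$ (if it exists), and $D_F^\alpha h(x)=0$ for $x\notin F$; $\int_c^d h\,d_F^\alpha t$ is the common value, if they agree, of the infimum of the upper sums and the supremum of the lower sums obtained by weighting the supremum, respectively infimum, of $h$ over $F\cap[x_i,x_{i+1}]$ (taken as $0$ if this set is empty) by $S_F^\alpha(x_{i+1})-S_F^\alpha(x_i)$. $(D_F^\alpha)^n$ is the $n$-fold iterate and a subscript as in $D_{F,\tau}^\alpha$ indicates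 the variable. The limits $S_F^\alpha(0)$, $S_F^\alpha(t)$ of the integral in $\tau$ mean that $\tau$ runs from $0$ to $t$. $C_F^\alpha[a,b]$ is the family of $\alpha$-order differentiable functions on $[a,b]$, and $C_F^{\alpha n}[a,b]$ the corresponding family for the $n$-fold derivative $(D_F^\alpha)^n$. The fractal Gamma function is $\Gamma_F^\alpha(x)=\int_0^\infty e^{-S_F^\alpha(t)}S_F^\alpha(t)^{S_F^\alpha(x)-1}\,d_F^\alpha t$. *)

theory Defs
  imports "HOL-Analysis.Analysis"
begin

definition subdivision :: "real \<Rightarrow> real \<Rightarrow> nat \<Rightarrow> (nat \<Rightarrow> real) \<Rightarrow> bool" where
  "subdivision x y m p \<longleftrightarrow> p 0 = x \<and> p m = y \<and> (\<forall>i<m. p i < p (Suc i))"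

definition flag :: "real set \<Rightarrow> real set \<Rightarrow> real" where
  "flag F I = (if F \<inter> I \<noteq> {} then 1 else 0)"

definition sigma_sum :: "real \<Rightarrow> real set \<Rightarrow> nat \<Rightarrow> (nat \<Rightarrow> real) \<Rightarrow> real" where
  "sigma_sum \<alpha> F m p =
     (\<Sum>i<m. (p (Suc i) - p i) powr \<alpha> / Gamma (\<alpha> + 1) * flag F {p i..p (Suc i)})"

definition coarse_mass :: "real \<Rightarrow> real set \<Rightarrow> real \<Rightarrow> real \<Rightarrow> real \<Rightarrow> real" where
  "coarse_mass \<alpha> F x y \<delta> =
     Inf {sigma_sum \<alpha> F m p | m p. subdivision x y m p \<and> (\<forall>i<m. p (Suc i) - p i \<le> \<delta>)}"

definition mass :: "real \<Rightarrow> real set \<Rightarrow> real \<Rightarrow> real \<Rightarrow> real" where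
  "mass \<alpha> F x y = Lim (at_right 0) (coarse_mass \<alpha> F x y)"

text \<open>The coarse mass grows as \<open>\<delta>\<close> decreases, so the limit defining the mass always exists in
  \<open>[0, \<infinity>]\<close>.  The following predicate says that it is finite on every interval, i.e. that the
  staircase function of \<open>F\<close> is real-valued.\<close>

definition finite_mass :: "real \<Rightarrow> real set \<Rightarrow> bool" where
  "finite_mass \<alpha> F \<longleftrightarrow>
     (\<forall>x y. x \<le> y \<longrightarrow> (\<exists>L. (coarse_mass \<alpha> F x y \<longlongrightarrow> L) (at_right 0)))"

definition staircase :: "real \<Rightarrow> real set \<Rightarrow> real \<Rightarrow> real \<Rightarrow> real" where
  "staircase \<alpha> F l x = (if l \<le> x then mass \<alpha> F l x else - mass \<alpha> F x l)"

text \<open>Functions on \<open>[a, b]\<close> are total functions that are only looked at on \<open>[a, b]\<close>; accordingly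
  the limit in the derivative runs through the points of \<open>F\<close> lying in the domain \<open>I\<close>
  (one-sided at the end points of an interval).  The limit is only said to exist when \<open>x\<close> is a
  limit point of \<open>F \<inter> I\<close> and the difference quotient has a nonzero denominator near \<open>x\<close>.\<close>

definition F_quotient ::
    "real \<Rightarrow> real set \<Rightarrow> real \<Rightarrow> (real \<Rightarrow> real) \<Rightarrow> real \<Rightarrow> real \<Rightarrow> real" where
  "F_quotient \<alpha> F l h x y = (h y - h x) / (staircase \<alpha> F l y - staircase \<alpha> F l x)"

definition F_differentiable ::
    "real \<Rightarrow> real set \<Rightarrow> real \<Rightarrow> real set \<Rightarrow> (real \<Rightarrow> real) \<Rightarrow> real \<Rightarrow> bool" where
  "F_differentiable \<alpha> F l I h x \<longleftrightarrow>
     x islimpt (F \<inter> I) \<and>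
     (\<forall>\<^sub>F y in at x within (F \<inter> I). staircase \<alpha> F l y \<noteq> staircase \<alpha> F l x) \<and>
     (\<exists>D. (F_quotient \<alpha> F l h x \<longlongrightarrow> D) (at x within (F \<inter> I)))"

definition F_deriv ::
    "real \<Rightarrow> real set \<Rightarrow> real \<Rightarrow> real set \<Rightarrow> (real \<Rightarrow> real) \<Rightarrow> real \<Rightarrow> real" where
  "F_deriv \<alpha> F l I h x =
     (if x \<in> F \<inter> I then Lim (at x within (F \<inter> I)) (F_quotient \<alpha> F l h x) else 0)"

definition C_F :: "real \<Rightarrow> real set \<Rightarrow> real \<Rightarrow> nat \<Rightarrow> real \<Rightarrow> real \<Rightarrow> (real \<Rightarrow> real) set" where
  "C_F \<alpha> F l n a b =
     {h. \<forall>k<n. \<forall>x\<in>F \<inter> {a..b}. F_differentiable \<alpha> F l {a..b} ((F_deriv \<alpha> F l {a..b} ^^ k) h) x}"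

definition sup_on :: "real set \<Rightarrow> (real \<Rightarrow> real) \<Rightarrow> real set \<Rightarrow> real" where
  "sup_on F h I = (if F \<inter> I \<noteq> {} then Sup (h ` (F \<inter> I)) else 0)"

definition inf_on :: "real set \<Rightarrow> (real \<Rightarrow> real) \<Rightarrow> real set \<Rightarrow> real" where
  "inf_on F h I = (if F \<inter> I \<noteq> {} then Inf (h ` (F \<inter> I)) else 0)"

definition upper_sum ::
    "real \<Rightarrow> real set \<Rightarrow> real \<Rightarrow> (real \<Rightarrow> real) \<Rightarrow> nat \<Rightarrow> (nat \<Rightarrow> real) \<Rightarrow> real" where
  "upper_sum \<alpha> F l h m p =
     (\<Sum>i<m. sup_on F h {p i..p (Suc i)} * (staircase \<alpha> F l (p (Suc i)) - staircase \<alpha> F l (p i)))"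

definition lower_sum ::
    "real \<Rightarrow> real set \<Rightarrow> real \<Rightarrow> (real \<Rightarrow> real) \<Rightarrow> nat \<Rightarrow> (nat \<Rightarrow> real) \<Rightarrow> real" where
  "lower_sum \<alpha> F l h m p =
     (\<Sum>i<m. inf_on F h {p i..p (Suc i)} * (staircase \<alpha> F l (p (Suc i)) - staircase \<alpha> F l (p i)))"

text \<open>Boundedness on \<open>F \<inter> [c, d]\<close> makes all the suprema and infima real.\<close>

definition has_F_integral ::
    "real \<Rightarrow> real set \<Rightarrow> real \<Rightarrow> (real \<Rightarrow> real) \<Rightarrow> real \<Rightarrow> real \<Rightarrow> real \<Rightarrow> bool" where
  "has_F_integral \<alpha> F l h c d v \<longleftrightarrow>
     c \<le> d \<and> bounded (h ` (F \<inter> {c..d})) \<and>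
     Inf {upper_sum \<alpha> F l h m p | m p. subdivision c d m p} = v \<and>
     Sup {lower_sum \<alpha> F l h m p | m p. subdivision c d m p} = v"

definition F_integral ::
    "real \<Rightarrow> real set \<Rightarrow> real \<Rightarrow> (real \<Rightarrow> real) \<Rightarrow> real \<Rightarrow> real \<Rightarrow> real" where
  "F_integral \<alpha> F l h c d = (THE v. has_F_integral \<alpha> F l h c d v)"

text \<open>The kernel \<open>(S(t) - S(\<tau>))\<^sup>-\<^sup>\<gamma>\<close> is unbounded where \<open>S(\<tau>)\<close> reaches \<open>S(t)\<close>, so its integral is
  improper at the upper end.  If \<open>t\<close> lies in a gap of \<open>F\<close>, the value \<open>S(t)\<close> is already reached
  at the left edge of the gap; the limit is therefore taken at the point \<open>growth_end\<close> after which
  the staircase does not grow any more, and the stretch from there to \<open>d\<close>, on which all weights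
  are 0, does not contribute.  For a finite mass the staircase is continuous, so that this is the
  value of \<open>has_F_integral\<close> whenever the latter exists.\<close>

definition growth_end :: "real \<Rightarrow> real set \<Rightarrow> real \<Rightarrow> real \<Rightarrow> real \<Rightarrow> real" where
  "growth_end \<alpha> F l c d =
     Sup {u \<in> {c..d}. u = c \<or> staircase \<alpha> F l u < staircase \<alpha> F l d}"

definition has_improper_F_integral ::
    "real \<Rightarrow> real set \<Rightarrow> real \<Rightarrow> (real \<Rightarrow> real) \<Rightarrow> real \<Rightarrow> real \<Rightarrow> real \<Rightarrow> bool" where
  "has_improper_F_integral \<alpha> F l h c d v \<longleftrightarrow>
     c \<le> d \<and>
     (let e = growth_end \<alpha> F l c d in
        if e = c then v = 0
        else \<exists>J. (\<forall>u\<in>{c..<e}. has_F_integral \<alpha> F l h c u (J u)) \<and> (J \<longlongrightarrow> v) (at_left e))"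

text \<open>The integrand of the fractal Gamma function may be unbounded where \<open>S(t)\<close> leaves its value
  at 0, so the integral is improper at that point as well as at infinity.\<close>

definition fractal_Gamma :: "real \<Rightarrow> real set \<Rightarrow> real \<Rightarrow> real \<Rightarrow> real" where
  "fractal_Gamma \<alpha> F l x =
     (let S = staircase \<alpha> F l; start = Inf {u. 0 \<le> u \<and> S 0 < S u} in
      if \<forall>u\<ge>0. S u = S 0 then 0
      else Lim (at_right start \<times>\<^sub>F at_top)
             (\<lambda>(u, T). F_integral \<alpha> F l (\<lambda>t. exp (- S t) * S t powr (S x - 1)) u T))"

text \<open>A function \<open>f\<close> of \<open>S(t)\<close> on \<open>[a, b]\<close> is differentiated as the function \<open>\<tau> \<mapsto> f(S(\<tau>))\<close>
  of \<open>\<tau>\<close>.\<close>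

definition frac_integrand ::
    "real \<Rightarrow> real set \<Rightarrow> real \<Rightarrow> real \<Rightarrow> real \<Rightarrow> nat \<Rightarrow> real \<Rightarrow> (real \<Rightarrow> real) \<Rightarrow> real \<Rightarrow> real \<Rightarrow> real" where
  "frac_integrand \<alpha> F l a b n \<gamma> f t \<tau> =
     (F_deriv \<alpha> F l {a..b} ^^ n) (\<lambda>s. f (staircase \<alpha> F l s)) \<tau> /
     (staircase \<alpha> F l t - staircase \<alpha> F l \<tau>) powr \<gamma>"

text \<open>The factor in front of the integral is the same for all \<open>f\<close>, so whether the fractal time
  derivative of \<open>f\<close> exists at \<open>t\<close> is decided by the integral.\<close>

definition has_frac_time_deriv ::
    "real \<Rightarrow> real set \<Rightarrow> real \<Rightarrow> real \<Rightarrow> real \<Rightarrow> nat \<Rightarrow> real \<Rightarrow> (real \<Rightarrow> real) \<Rightarrow> real \<Rightarrow> bool" where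
  "has_frac_time_deriv \<alpha> F l a b n \<gamma> f t \<longleftrightarrow>
     (\<exists>v. has_improper_F_integral \<alpha> F l (frac_integrand \<alpha> F l a b n \<gamma> f t) 0 t v)"

definition frac_time_deriv ::
    "real \<Rightarrow> real set \<Rightarrow> real \<Rightarrow> real \<Rightarrow> real \<Rightarrow> nat \<Rightarrow> real \<Rightarrow> (real \<Rightarrow> real) \<Rightarrow> real \<Rightarrow> real" where
  "frac_time_deriv \<alpha> F l a b n \<gamma> f t =
     1 / fractal_Gamma \<alpha> F l (real n - \<gamma>) *
     (THE v. has_improper_F_integral \<alpha> F l (frac_integrand \<alpha> F l a b n \<gamma> f t) 0 t v)"

end

(* The staircase S is nondecreasing and constant across gaps of F: refining a subdivision at one
   extra point changes sigma by at most a multiple of \<delta>^\<alpha>, so the mass is additive, and it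
   vanishes on intervals missing F.  Hence upper and lower sums behave under refinement as for a
   Darboux-Stieltjes integral with integrator S, which makes the integral, and its improper version,
   linear.  The iterated derivative is linear at points of F because it is a limit of quotients, and
   it vanishes off F. *)
theory Submission
  imports Defs
begin

text \<open>Cells are treated through arbitrary functionals \<phi> of their two end points, because
  the additivity of the mass and the refinement of upper sums differ only in the defect that \<phi>
  shows when a cell is cut. Inserting one point cuts at most one cell, so the defect is paid once;
  for upper sums it is zero. Subdivisions are always produced before \<phi> is quantified, so that
  one refinement controls the upper sums of several integrands at once, as the sum of two integrals
  requires. The obstacle is the default value 0 of the supremum over a cell that misses F: for a
  negative integrand it exceeds the suprema over larger cells, so suprema alone are not monotone.
  Only the products with the increments of S are, since these increments vanish on such
  cells.\<close>

definition interval_sum :: "(real \<Rightarrow> real \<Rightarrow> real) \<Rightarrow> nat \<Rightarrow> (nat \<Rightarrow> real) \<Rightarrow> real" where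
  "interval_sum \<phi> m p = (\<Sum>i<m. \<phi> (p i) (p (Suc i)))"

definition fine_subdivision :: "real \<Rightarrow> real \<Rightarrow> real \<Rightarrow> nat \<Rightarrow> (nat \<Rightarrow> real) \<Rightarrow> bool" where
  "fine_subdivision \<delta> x y m p \<longleftrightarrow> subdivision x y m p \<and> (\<forall>i<m. p (Suc i) - p i \<le> \<delta>)"

text \<open>This is the property under which cutting a cell never increases the sum. It is confined
  to [c, d] because integrands are bounded only there. The case x = y forces \<phi> x x \<le>
  0.\<close>

definition superadditive_on :: "real \<Rightarrow> real \<Rightarrow> (real \<Rightarrow> real \<Rightarrow> real) \<Rightarrow> bool" where
  "superadditive_on c d \<phi> \<longleftrightarrow>
     (\<forall>x y z. c \<le> x \<longrightarrow> x \<le> y \<longrightarrow> y \<le> z \<longrightarrow> z \<le> d \<longrightarrow> \<phi> x y + \<phi> y z \<le> \<phi> x z)"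

section \<open>Subdivisions\<close>

lemma subdivision_mono:
  assumes "subdivision x y m p" "i \<le> j" "j \<le> m"
  shows "p i \<le> p j"
  using assms(2,3)
proof (induction j rule: dec_induct)
  case (step j)
  then have "p j < p (Suc j)" using assms(1) by (auto simp: subdivision_def)
  with step show ?case by simp
qed simp

lemma subdivision_le: "subdivision x y m p \<Longrightarrow> x \<le> y"
  using subdivision_mono[of x y m p 0 m] by (simp add: subdivision_def)

lemma subdivision_bounds:
  assumes "subdivision x y m p" "i < m"
  shows "x \<le> p i" "p i \<le> p (Suc i)" "p (Suc i) \<le> y"
  using subdivision_mono[OF assms(1), of 0 i] subdivision_mono[OF assms(1), of i "Suc i"]
    subdivision_mono[OF assms(1), of "Suc i" m] assms
  by (auto simp: subdivision_def)

text \<open>With the length of the interval as mesh bound, joining and splitting of fine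
  subdivisions also serve subdivisions without any bound on the mesh.\<close>

lemma fine_subdivision_width:
  "subdivision x y m p \<Longrightarrow> fine_subdivision (y - x) x y m p"
  using subdivision_bounds by (fastforce simp: fine_subdivision_def)

lemma fine_subdivision_exists:
  assumes "x \<le> y" "0 < \<delta>"
  obtains m p where "fine_subdivision \<delta> x y m p"
proof (cases "x = y")
  case True
  \<comment> \<open>Nodes increase strictly, so over a single point only the subdivision without
    cells is available.\<close>
  then have "fine_subdivision \<delta> x y 0 (\<lambda>_. x)"
    by (simp add: fine_subdivision_def subdivision_def)
  then show ?thesis using that by blast
next
  case False
  then have "x < y" using assms by simp
  obtain N :: nat where N: "(y - x) / \<delta> < real N" using reals_Archimedean2 by blast
  have "0 < (y - x) / \<delta>" using \<open>x < y\<close> assms by simp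
  then have "0 < real N" using N by linarith
  define p where "p i = x + real i * ((y - x) / real N)" for i :: nat
  have diff: "p (Suc i) - p i = (y - x) / real N" for i 
    by (simp add: p_def diff_divide_distrib add_divide_distrib algebra_simps)
  have "0 < (y - x) / real N" "(y - x) / real N \<le> \<delta>"
    using N \<open>0 < real N\<close> \<open>x < y\<close> assms by (simp_all add: field_simps)
  then have "p i < p (Suc i)" "p (Suc i) - p i \<le> \<delta>" for i
    using diff[of i] by linarith+
  moreover have "p 0 = x" "p N = y" using \<open>0 < real N\<close> by (simp_all add: p_def)
  ultimately have "fine_subdivision \<delta> x y N p"
    by (simp add: fine_subdivision_def subdivision_def)
  then show ?thesis using that by blast
qed

lemma fine_subdivision_single:
  assumes "x < y" "y - x \<le> \<delta>"
  obtains p where "fine_subdivision \<delta> x y 1 p" "\<And>\<phi>. interval_sum \<phi> 1 p = \<phi> x y"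
  using that[of "\<lambda>i. if i = 0 then x else y"] assms
  by (simp add: fine_subdivision_def subdivision_def interval_sum_def)

lemma fine_subdivision_join:
  assumes p: "fine_subdivision \<delta> x y m p" and q: "fine_subdivision \<delta> y z k q"
  obtains r where "fine_subdivision \<delta> x z (m + k) r"
    "\<And>\<phi>. interval_sum \<phi> (m + k) r = interval_sum \<phi> m p + interval_sum \<phi> k q"
proof -
  define r where "r i = (if i < m then p i else q (i - m))" for i
  have mid: "p m = y" "q 0 = y" using p q by (auto simp: fine_subdivision_def subdivision_def)
  \<comment> \<open>For Suc i = m the node is taken from q, and q 0 = y = p m makes the two pieces
    fit.\<close>
  have lo: "r i = p i" "r (Suc i) = p (Suc i)" if "i < m" for i
    using that mid by (auto simp: r_def not_less Suc_le_eq dest: le_less_Suc_eq)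
  have hi: "r (m + i) = q i" "r (Suc (m + i)) = q (Suc i)" for i
    by (simp_all add: r_def flip: add_Suc_right)
  have cells: "\<exists>j<k. i = m + j" if "i < m + k" "\<not> i < m" for i
    using that by (intro exI[of _ "i - m"]) auto
  have "p 0 = x" "q k = z" using p q by (auto simp: fine_subdivision_def subdivision_def)
  then have "r 0 = x" "r (m + k) = z"
    using mid lo(1)[of 0] hi(1)[of k] hi(1)[of 0] by (cases "m = 0"; simp)+
  moreover have "r i < r (Suc i) \<and> r (Suc i) - r i \<le> \<delta>" if i: "i < m + k" for i
  proof (cases "i < m")
    case True
    then show ?thesis using lo p by (simp add: fine_subdivision_def subdivision_def)
  next
    case False
    then obtain j where "j < k" "i = m + j" using cells i by blast
    then show ?thesis using hi q by (simp add: fine_subdivision_def subdivision_def)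
  qed
  ultimately have "fine_subdivision \<delta> x z (m + k) r"
    by (simp add: fine_subdivision_def subdivision_def)
  moreover have "interval_sum \<phi> (m + n) r = interval_sum \<phi> m p + interval_sum \<phi> n q" for \<phi> n
  proof (induction n)
    case 0
    then show ?case using lo by (simp add: interval_sum_def)
  next
    case (Suc n)
    then show ?case using hi by (simp add: interval_sum_def)
  qed
  ultimately show ?thesis using that by blast
qed

text \<open>At most one cell contains y in its interior. Cutting it at y costs at most C by the
  condition on cells around y; all other cells are kept. If y is already a node, nothing is cut, and
  0 \<le> C absorbs this case.\<close>

lemma fine_subdivision_split:
  assumes "fine_subdivision \<delta> x z m p" "x \<le> y" "y \<le> z"
  shows "\<exists>m1 p1 m2 p2. fine_subdivision \<delta> x y m1 p1 \<and> fine_subdivision \<delta> y z m2 p2 \<and>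
    (\<forall>\<phi> C. 0 \<le> C \<longrightarrow>
       (\<forall>w w'. x \<le> w \<longrightarrow> w \<le> y \<longrightarrow> y \<le> w' \<longrightarrow> w' \<le> z \<longrightarrow> w' - w \<le> \<delta> \<longrightarrow>
          \<phi> w y + \<phi> y w' \<le> \<phi> w w' + C) \<longrightarrow>
       interval_sum \<phi> m1 p1 + interval_sum \<phi> m2 p2 \<le> interval_sum \<phi> m p + C)"
  using assms
proof (induction m arbitrary: z)
  case 0
  then have eq: "x = y" "z = y" by (auto simp: fine_subdivision_def subdivision_def)
  with 0 have "fine_subdivision \<delta> y y 0 p" by simp
  then show ?case unfolding eq
    by (intro exI[of _ 0] exI[of _ p]) (simp add: interval_sum_def)
next
  case (Suc m)
  define u where "u = p m"
  have u: "fine_subdivision \<delta> x u m p" "u < z" "z - u \<le> \<delta>" "p (Suc m) = z"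
    using Suc.prems(1) by (auto simp: fine_subdivision_def subdivision_def u_def)
  have "x \<le> u" using subdivision_le u(1) by (auto simp: fine_subdivision_def)
  have sum_p: "interval_sum \<phi> (Suc m) p = interval_sum \<phi> m p + \<phi> u z" for \<phi>
    using u(4) by (simp add: interval_sum_def u_def)
  \<comment> \<open>The last cell is [u, z]. Only in the third case is it cut; in the first it is
    appended to the right part given by the induction hypothesis.\<close>
  consider "y \<le> u" | "y = z" | "u < y" "y < z" using Suc.prems by linarith
  then show ?case
  proof cases
    case 1
    then obtain m1 p1 m2 p2 where IH: "fine_subdivision \<delta> x y m1 p1" "fine_subdivision \<delta> y u m2 p2"
      "\<And>\<phi> C. 0 \<le> C \<Longrightarrow> (\<forall>w w'. x \<le> w \<longrightarrow> w \<le> y \<longrightarrow> y \<le> w' \<longrightarrow> w' \<le> u \<longrightarrow> w' - w \<le> \<delta> \<longrightarrow>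
          \<phi> w y + \<phi> y w' \<le> \<phi> w w' + C) \<Longrightarrow>
       interval_sum \<phi> m1 p1 + interval_sum \<phi> m2 p2 \<le> interval_sum \<phi> m p + C"
      using Suc.IH[OF u(1) Suc.prems(2)] by blast
    obtain s where s: "fine_subdivision \<delta> u z 1 s" "\<And>\<phi>. interval_sum \<phi> 1 s = \<phi> u z"
      using fine_subdivision_single u(2,3) by blast
    obtain r where r: "fine_subdivision \<delta> y z (m2 + 1) r"
      "\<And>\<phi>. interval_sum \<phi> (m2 + 1) r = interval_sum \<phi> m2 p2 + interval_sum \<phi> 1 s"
      using fine_subdivision_join[OF IH(2) s(1)] by blast
    have "interval_sum \<phi> m1 p1 + interval_sum \<phi> (m2 + 1) r \<le> interval_sum \<phi> (Suc m) p + C"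
      if "0 \<le> C" and "\<forall>w w'. x \<le> w \<longrightarrow> w \<le> y \<longrightarrow> y \<le> w' \<longrightarrow> w' \<le> z \<longrightarrow> w' - w \<le> \<delta> \<longrightarrow>
          \<phi> w y + \<phi> y w' \<le> \<phi> w w' + C" for \<phi> C
    proof -
      have "interval_sum \<phi> m1 p1 + interval_sum \<phi> m2 p2 \<le> interval_sum \<phi> m p + C"
        using that u(2) by (intro IH(3)) auto
      then show ?thesis unfolding r(2) s(2) sum_p by linarith
    qed
    then show ?thesis using IH(1) r(1) by blast
  next
    case 2
    have "fine_subdivision \<delta> z z 0 (\<lambda>_. z)" by (simp add: fine_subdivision_def subdivision_def)
    moreover have "interval_sum \<phi> 0 (\<lambda>_. z) = 0" for \<phi> by (simp add: interval_sum_def)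
    ultimately show ?thesis using Suc.prems(1) 2
      by (intro exI[of _ "Suc m"] exI[of _ p] exI[of _ 0] exI[of _ "\<lambda>_. z"]) simp
  next
    case 3
    obtain s where s: "fine_subdivision \<delta> u y 1 s" "\<And>\<phi>. interval_sum \<phi> 1 s = \<phi> u y"
      using fine_subdivision_single[of u y \<delta>] 3 u(3) by (metis diff_right_mono less_imp_le order_trans)
    obtain s' where s': "fine_subdivision \<delta> y z 1 s'" "\<And>\<phi>. interval_sum \<phi> 1 s' = \<phi> y z"
      using fine_subdivision_single[of y z \<delta>] 3 u(3) by (metis diff_left_mono less_imp_le order_trans)
    obtain r where r: "fine_subdivision \<delta> x y (m + 1) r"
      "\<And>\<phi>. interval_sum \<phi> (m + 1) r = interval_sum \<phi> m p + interval_sum \<phi> 1 s"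
      using fine_subdivision_join[OF u(1) s(1)] by blast
    have "interval_sum \<phi> (m + 1) r + interval_sum \<phi> 1 s' \<le> interval_sum \<phi> (Suc m) p + C"
      if "\<forall>w w'. x \<le> w \<longrightarrow> w \<le> y \<longrightarrow> y \<le> w' \<longrightarrow> w' \<le> z \<longrightarrow> w' - w \<le> \<delta> \<longrightarrow>
          \<phi> w y + \<phi> y w' \<le> \<phi> w w' + C" for \<phi> C
    proof -
      have "\<phi> u y + \<phi> y z \<le> \<phi> u z + C" using that 3 \<open>x \<le> u\<close> u(3) by simp
      then show ?thesis unfolding r(2) s(2) s'(2) sum_p by linarith
    qed
    then show ?thesis using r(1) s'(1) by blast
  qed
qed

lemma superadditive_on_subset:
  "superadditive_on c d \<phi> \<Longrightarrow> c \<le> c' \<Longrightarrow> d' \<le> d \<Longrightarrow> superadditive_on c' d' \<phi>"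
  unfolding superadditive_on_def by (meson order_trans)

lemma interval_sum_le_superadditive:
  assumes "superadditive_on x y \<phi>" "subdivision x y m p" "x < y"
  shows "interval_sum \<phi> m p \<le> \<phi> x y"
  using assms
proof (induction m arbitrary: y)
  case 0
  then show ?case by (simp add: subdivision_def)
next
  case (Suc m)
  have p: "subdivision x (p m) m p" "p m < y" "p (Suc m) = y"
    using Suc.prems(2) by (auto simp: subdivision_def)
  have "x \<le> p m" using p(1) by (rule subdivision_le)
  show ?case
  proof (cases "m = 0")
    case True
    then show ?thesis using p by (simp add: interval_sum_def subdivision_def)
  next
    case False
    then have "p 0 < p (Suc 0)" using Suc.prems(2) by (auto simp only: subdivision_def zero_less_Suc)
    also have "p (Suc 0) \<le> p m" using subdivision_mono[OF p(1), of "Suc 0" m] False by simp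
    finally have "x < p m" using Suc.prems(2) by (simp only: subdivision_def)
    then have "interval_sum \<phi> m p \<le> \<phi> x (p m)"
      using Suc.IH[OF _ p(1)] superadditive_on_subset[OF Suc.prems(1)] p(2) by simp
    moreover have "\<phi> x (p m) + \<phi> (p m) y \<le> \<phi> x y"
      using Suc.prems(1) \<open>x < p m\<close> p(2) by (simp add: superadditive_on_def)
    ultimately show ?thesis using p(3) by (simp add: interval_sum_def)
  qed
qed

text \<open>By induction on the number of cells of p, q is split at the last interior node u of p.
  Its left part is refined together with the left part of p by the induction hypothesis; its right
  part refines the last cell [u, d] of p.\<close>

lemma common_refinement:
  assumes "subdivision c d m p" "subdivision c d k q"
  shows "\<exists>n r. subdivision c d n r \<and> (\<forall>\<phi>. superadditive_on c d \<phi> \<longrightarrow>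
    interval_sum \<phi> n r \<le> interval_sum \<phi> m p \<and> interval_sum \<phi> n r \<le> interval_sum \<phi> k q)"
  using assms
proof (induction m arbitrary: d k q)
  case 0
  then have "c = d" by (simp add: subdivision_def)
  with 0(2) have "k = 0" using subdivision_bounds(1,3)[OF 0(2), of 0]
    by (cases k) (auto simp: subdivision_def)
  then show ?case using 0(1) by (intro exI[of _ 0] exI[of _ p]) (simp add: interval_sum_def)
next
  case (Suc m)
  define u where "u = p m"
  have u: "subdivision c u m p" "u < d" "p (Suc m) = d"
    using Suc.prems(1) by (auto simp: subdivision_def u_def)
  have "c \<le> u" using u(1) by (rule subdivision_le)
  \<comment> \<open>The mesh bound d - c is no restriction. It is kept for both halves so that they
    can be joined again.\<close>
  obtain m1 p1 m2 p2 where Q: "fine_subdivision (d - c) c u m1 p1" "fine_subdivision (d - c) u d m2 p2"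
    "\<And>\<phi> C. 0 \<le> C \<Longrightarrow> (\<forall>w w'. c \<le> w \<longrightarrow> w \<le> u \<longrightarrow> u \<le> w' \<longrightarrow> w' \<le> d \<longrightarrow> w' - w \<le> d - c \<longrightarrow>
        \<phi> w u + \<phi> u w' \<le> \<phi> w w' + C) \<Longrightarrow>
     interval_sum \<phi> m1 p1 + interval_sum \<phi> m2 p2 \<le> interval_sum \<phi> k q + C"
    using fine_subdivision_split[OF fine_subdivision_width[OF Suc.prems(2)] \<open>c \<le> u\<close>] u(2)
    by (metis less_imp_le)
  obtain n r where R: "subdivision c u n r" "\<And>\<phi>. superadditive_on c u \<phi> \<Longrightarrow>
      interval_sum \<phi> n r \<le> interval_sum \<phi> m p \<and> interval_sum \<phi> n r \<le> interval_sum \<phi> m1 p1"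
    using Suc.IH[OF u(1)] Q(1) unfolding fine_subdivision_def by blast
  have "fine_subdivision (d - c) c u n r"
    using fine_subdivision_width[OF R(1)] u(2) by (fastforce simp: fine_subdivision_def)
  then obtain s where s: "fine_subdivision (d - c) c d (n + m2) s"
    "\<And>\<phi>. interval_sum \<phi> (n + m2) s = interval_sum \<phi> n r + interval_sum \<phi> m2 p2"
    using fine_subdivision_join[OF _ Q(2)] by blast
  have "interval_sum \<phi> (n + m2) s \<le> interval_sum \<phi> (Suc m) p \<and>
        interval_sum \<phi> (n + m2) s \<le> interval_sum \<phi> k q" if \<phi>: "superadditive_on c d \<phi>" for \<phi>
  proof -
    have "superadditive_on c u \<phi>" "superadditive_on u d \<phi>"
      using superadditive_on_subset[OF \<phi>] \<open>c \<le> u\<close> u(2) by auto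
    then have "interval_sum \<phi> n r \<le> interval_sum \<phi> m p" "interval_sum \<phi> n r \<le> interval_sum \<phi> m1 p1"
      "interval_sum \<phi> m2 p2 \<le> \<phi> u d"
      using R(2) interval_sum_le_superadditive u(2) Q(2) by (auto simp: fine_subdivision_def)
    \<comment> \<open>Superadditivity is the cutting condition with defect C = 0.\<close>
    moreover have "interval_sum \<phi> m1 p1 + interval_sum \<phi> m2 p2 \<le> interval_sum \<phi> k q + 0"
      using \<phi> by (intro Q(3)) (auto simp: superadditive_on_def)
    moreover have "interval_sum \<phi> (Suc m) p = interval_sum \<phi> m p + \<phi> u d"
      using u(3) by (simp add: interval_sum_def u_def)
    ultimately show ?thesis unfolding s(2) by linarith
  qed
  then show ?case using s(1) by (auto simp: fine_subdivision_def)
qed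

section \<open>Upper and lower sums\<close>

lemma upper_sum_eq: "upper_sum \<alpha> F l h = interval_sum
    (\<lambda>u v. sup_on F h {u..v} * (staircase \<alpha> F l v - staircase \<alpha> F l u))"
  by (intro ext) (simp add: upper_sum_def interval_sum_def)

text \<open>The default value 0 on cells that miss F is its own negative, so the identity holds cell
  by cell. Through it lower sums need no refinement theory of their own.\<close>

lemma lower_sum_eq: "lower_sum \<alpha> F l h m p = - upper_sum \<alpha> F l (\<lambda>x. - h x) m p"
  unfolding lower_sum_def upper_sum_def sum_negf[symmetric]
  by (intro sum.cong) (simp_all add: inf_on_def sup_on_def Inf_real_def image_image)

lemma sup_on_upper:
  "bounded (h ` (F \<inter> I)) \<Longrightarrow> x \<in> F \<inter> I \<Longrightarrow> h x \<le> sup_on F h I"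
  by (auto simp: sup_on_def intro!: cSup_upper bounded_imp_bdd_above)

text \<open>A cell that misses F has to be excluded: its value is 0, whereas C may be
  negative.\<close>

lemma sup_on_least:
  "F \<inter> I \<noteq> {} \<Longrightarrow> (\<And>x. x \<in> F \<inter> I \<Longrightarrow> h x \<le> C) \<Longrightarrow> sup_on F h I \<le> C"
  by (auto simp: sup_on_def intro!: cSup_least)

lemma bounded_image_subinterval:
  fixes c d :: real
  assumes "bounded (h ` (F \<inter> {c..d}))" "c \<le> x" "y \<le> d"
  shows "bounded (h ` (F \<inter> {x..y}))"
  using assms(1) by (rule bounded_subset) (use assms(2,3) in auto)

lemma bounded_image_minus:
  fixes h :: "real \<Rightarrow> real"
  shows "bounded (h ` A) \<Longrightarrow> bounded ((\<lambda>x. - h x) ` A)"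
  by (auto simp: bounded_iff)

section \<open>The staircase function\<close>

definition cell_mass :: "real \<Rightarrow> real set \<Rightarrow> real \<Rightarrow> real \<Rightarrow> real" where
  "cell_mass \<alpha> F u v = (v - u) powr \<alpha> / Gamma (\<alpha> + 1) * flag F {u..v}"

lemma sigma_sum_eq: "sigma_sum \<alpha> F = interval_sum (cell_mass \<alpha> F)"
  by (intro ext) (simp add: sigma_sum_def interval_sum_def cell_mass_def)

lemma coarse_mass_eq:
  "coarse_mass \<alpha> F x y \<delta> =
     Inf {interval_sum (cell_mass \<alpha> F) m p | m p. fine_subdivision \<delta> x y m p}"
  by (simp add: coarse_mass_def sigma_sum_eq fine_subdivision_def)

section \<open>Additivity of the coarse mass up to an error that vanishes with \<delta>\<close>

context
  fixes \<alpha> :: real and F :: "real set"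
  assumes \<alpha>: "0 < \<alpha>"
begin

lemma cell_mass_nonneg: "0 \<le> cell_mass \<alpha> F u v"
  using \<alpha> Gamma_real_pos[of "\<alpha> + 1"] by (simp add: cell_mass_def flag_def)

lemma cell_mass_le:
  assumes "u \<le> v" "v - u \<le> \<delta>"
  shows "cell_mass \<alpha> F u v \<le> \<delta> powr \<alpha> / Gamma (\<alpha> + 1)"
proof -
  have "(v - u) powr \<alpha> \<le> \<delta> powr \<alpha>" using assms \<alpha> by (intro powr_mono2) auto
  then show ?thesis using \<alpha> Gamma_real_pos[of "\<alpha> + 1"]
    by (simp add: cell_mass_def flag_def divide_right_mono)
qed

lemma interval_sum_cell_mass_nonneg: "0 \<le> interval_sum (cell_mass \<alpha> F) m p"
  by (simp add: interval_sum_def sum_nonneg cell_mass_nonneg)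

lemma coarse_mass_le:
  "fine_subdivision \<delta> x y m p \<Longrightarrow> coarse_mass \<alpha> F x y \<delta> \<le> interval_sum (cell_mass \<alpha> F) m p"
  unfolding coarse_mass_eq
  by (rule cInf_lower) (auto intro!: bdd_belowI[of _ 0] interval_sum_cell_mass_nonneg)

lemma coarse_mass_greatest:
  assumes "x \<le> y" "0 < \<delta>"
    and "\<And>m p. fine_subdivision \<delta> x y m p \<Longrightarrow> C \<le> interval_sum (cell_mass \<alpha> F) m p"
  shows "C \<le> coarse_mass \<alpha> F x y \<delta>"
  unfolding coarse_mass_eq
proof (rule cInf_greatest)
  obtain m p where "fine_subdivision \<delta> x y m p" using fine_subdivision_exists assms(1,2) by blast
  then show "{interval_sum (cell_mass \<alpha> F) m p |m p. fine_subdivision \<delta> x y m p} \<noteq> {}" by blast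
qed (use assms(3) in blast)

lemma coarse_mass_nonneg: "x \<le> y \<Longrightarrow> 0 < \<delta> \<Longrightarrow> 0 \<le> coarse_mass \<alpha> F x y \<delta>"
  by (simp add: coarse_mass_greatest interval_sum_cell_mass_nonneg)

text \<open>Joined subdivisions have added sums. The infimum over the left pieces is taken with the
  right piece fixed, then the infimum over the right pieces.\<close>

lemma coarse_mass_add_ge:
  assumes "x \<le> y" "y \<le> z" "0 < \<delta>"
  shows "coarse_mass \<alpha> F x z \<delta> \<le> coarse_mass \<alpha> F x y \<delta> + coarse_mass \<alpha> F y z \<delta>"
proof -
  have "coarse_mass \<alpha> F x z \<delta> - coarse_mass \<alpha> F x y \<delta> \<le> coarse_mass \<alpha> F y z \<delta>"
  proof (rule coarse_mass_greatest[OF assms(2,3)])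
    fix k q assume q: "fine_subdivision \<delta> y z k q"
    have "coarse_mass \<alpha> F x z \<delta> - interval_sum (cell_mass \<alpha> F) k q \<le> coarse_mass \<alpha> F x y \<delta>"
    proof (rule coarse_mass_greatest[OF assms(1,3)])
      fix m p assume "fine_subdivision \<delta> x y m p"
      then obtain r where "fine_subdivision \<delta> x z (m + k) r"
        "\<And>\<phi>. interval_sum \<phi> (m + k) r = interval_sum \<phi> m p + interval_sum \<phi> k q"
        using fine_subdivision_join[OF _ q] by blast
      then show "coarse_mass \<alpha> F x z \<delta> - interval_sum (cell_mass \<alpha> F) k q
          \<le> interval_sum (cell_mass \<alpha> F) m p"
        using coarse_mass_le by fastforce
    qed
    then show "coarse_mass \<alpha> F x z \<delta> - coarse_mass \<alpha> F x y \<delta> \<le> interval_sum (cell_mass \<alpha> F) k q"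
      by linarith
  qed
  then show ?thesis by linarith
qed

text \<open>The factor 2 counts the two pieces of the cell cut at y, each of mass at most
  \<open>\<delta> powr \<alpha> / Gamma (\<alpha> + 1)\<close>; the mass of the cut cell itself is
  estimated by 0 from below. For \<alpha> < 1 some error is unavoidable, since the powers of the
  pieces add up to more than the power of the whole.\<close>

lemma coarse_mass_add_le:
  assumes "x \<le> y" "y \<le> z" "0 < \<delta>"
  shows "coarse_mass \<alpha> F x y \<delta> + coarse_mass \<alpha> F y z \<delta>
    \<le> coarse_mass \<alpha> F x z \<delta> + 2 * (\<delta> powr \<alpha> / Gamma (\<alpha> + 1))"
proof -
  let ?C = "2 * (\<delta> powr \<alpha> / Gamma (\<alpha> + 1))"
  have C: "0 \<le> ?C" using \<alpha> Gamma_real_pos[of "\<alpha> + 1"] by simp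
  have "coarse_mass \<alpha> F x y \<delta> + coarse_mass \<alpha> F y z \<delta> - ?C \<le> coarse_mass \<alpha> F x z \<delta>"
  proof (rule coarse_mass_greatest)
    fix m p assume p: "fine_subdivision \<delta> x z m p"
    have cells: "\<forall>w w'. x \<le> w \<longrightarrow> w \<le> y \<longrightarrow> y \<le> w' \<longrightarrow> w' \<le> z \<longrightarrow> w' - w \<le> \<delta> \<longrightarrow>
        cell_mass \<alpha> F w y + cell_mass \<alpha> F y w' \<le> cell_mass \<alpha> F w w' + ?C"
    proof (intro allI impI)
      fix w w' assume "w \<le> y" "y \<le> w'" "w' - w \<le> \<delta>"
      then show "cell_mass \<alpha> F w y + cell_mass \<alpha> F y w' \<le> cell_mass \<alpha> F w w' + ?C"
        using cell_mass_le[of w y \<delta>] cell_mass_le[of y w' \<delta>] cell_mass_nonneg[of w w'] by linarith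
    qed
    obtain m1 p1 m2 p2 where *: "fine_subdivision \<delta> x y m1 p1" "fine_subdivision \<delta> y z m2 p2"
      "interval_sum (cell_mass \<alpha> F) m1 p1 + interval_sum (cell_mass \<alpha> F) m2 p2
        \<le> interval_sum (cell_mass \<alpha> F) m p + ?C"
      using fine_subdivision_split[OF p assms(1,2)] C cells by blast
    show "coarse_mass \<alpha> F x y \<delta> + coarse_mass \<alpha> F y z \<delta> - ?C \<le> interval_sum (cell_mass \<alpha> F) m p"
      using coarse_mass_le[OF *(1)] coarse_mass_le[OF *(2)] *(3) by linarith
  qed (use assms in auto)
  then show ?thesis by linarith
qed

lemma coarse_mass_gap:
  assumes "x \<le> y" "0 < \<delta>" "F \<inter> {x..y} = {}"
  shows "coarse_mass \<alpha> F x y \<delta> = 0"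
proof -
  obtain m p where p: "fine_subdivision \<delta> x y m p" using fine_subdivision_exists assms(1,2) by blast
  have "cell_mass \<alpha> F (p i) (p (Suc i)) = 0" if "i < m" for i
    using subdivision_bounds[of x y m p i] p that assms(3)
    by (force simp: fine_subdivision_def cell_mass_def flag_def)
  then have "interval_sum (cell_mass \<alpha> F) m p = 0" by (simp add: interval_sum_def)
  then show ?thesis using coarse_mass_le[OF p] coarse_mass_nonneg[OF assms(1,2)] by simp
qed

section \<open>The mass as a limit, and the staircase as its primitive\<close>

context
  assumes fin: "finite_mass \<alpha> F"
begin

lemma coarse_mass_tendsto: "x \<le> y \<Longrightarrow> (coarse_mass \<alpha> F x y \<longlongrightarrow> mass \<alpha> F x y) (at_right 0)"
  using fin tendsto_Lim[OF trivial_limit_at_right_real]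
  unfolding finite_mass_def mass_def by blast

lemma mass_nonneg:
  assumes "x \<le> y"
  shows "0 \<le> mass \<alpha> F x y"
proof (rule tendsto_lowerbound[OF coarse_mass_tendsto[OF assms]])
  show "\<forall>\<^sub>F \<delta> in at_right 0. 0 \<le> coarse_mass \<alpha> F x y \<delta>"
    using eventually_at_right_less coarse_mass_nonneg[OF assms] by (rule eventually_mono)
qed (rule trivial_limit_at_right_real)

lemma mass_gap:
  assumes "x \<le> y" "F \<inter> {x..y} = {}"
  shows "mass \<alpha> F x y = 0"
proof -
  have "\<forall>\<^sub>F \<delta> in at_right 0. coarse_mass \<alpha> F x y \<delta> = 0"
    using eventually_at_right_less coarse_mass_gap[OF assms(1) _ assms(2)] by (rule eventually_mono)
  then have "(coarse_mass \<alpha> F x y \<longlongrightarrow> 0) (at_right 0)" by (rule tendsto_eventually)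
  then show ?thesis
    using coarse_mass_tendsto[OF assms(1)] tendsto_unique trivial_limit_at_right_real by blast
qed

lemma mass_add:
  assumes "x \<le> y" "y \<le> z"
  shows "mass \<alpha> F x y + mass \<alpha> F y z = mass \<alpha> F x z"
proof (rule antisym)
  \<comment> \<open>This is the cost of the cut cell from \<open>coarse_mass_add_le\<close>; it
    tends to 0 because \<alpha> > 0.\<close>
  let ?\<epsilon> = "\<lambda>\<delta>::real. 2 * (\<delta> powr \<alpha> / Gamma (\<alpha> + 1))"
  have lim: "((\<lambda>\<delta>. coarse_mass \<alpha> F x y \<delta> + coarse_mass \<alpha> F y z \<delta>)
      \<longlongrightarrow> mass \<alpha> F x y + mass \<alpha> F y z) (at_right 0)"
    by (intro tendsto_add coarse_mass_tendsto assms)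
  have limz: "(coarse_mass \<alpha> F x z \<longlongrightarrow> mass \<alpha> F x z) (at_right 0)"
    using assms by (intro coarse_mass_tendsto) simp
  have \<Gamma>: "Gamma (\<alpha> + 1) \<noteq> 0" using \<alpha> Gamma_real_pos[of "\<alpha> + 1"] by fastforce
  have pos: "\<forall>\<^sub>F \<delta> in at_right 0. (0::real) < \<delta>" by (rule eventually_at_right_less)
  have "((\<lambda>\<delta>::real. \<delta> powr \<alpha>) \<longlongrightarrow> 0) (at_right 0)"
    using \<alpha> eventually_mono[OF pos less_imp_le]
    by (intro tendsto_zero_powrI[where b = \<alpha>] tendsto_const tendsto_ident_at) auto
  then have "(?\<epsilon> \<longlongrightarrow> 2 * (0 / Gamma (\<alpha> + 1))) (at_right 0)"
    using \<Gamma> by (intro tendsto_intros)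
  then have "((\<lambda>\<delta>. coarse_mass \<alpha> F x z \<delta> + ?\<epsilon> \<delta>) \<longlongrightarrow> mass \<alpha> F x z + 0) (at_right 0)"
    using limz by (intro tendsto_add) simp_all
  from tendsto_le[OF trivial_limit_at_right_real this lim]
  show "mass \<alpha> F x y + mass \<alpha> F y z \<le> mass \<alpha> F x z"
    using eventually_mono[OF pos coarse_mass_add_le[OF assms]] by simp
  from tendsto_le[OF trivial_limit_at_right_real lim limz]
  show "mass \<alpha> F x z \<le> mass \<alpha> F x y + mass \<alpha> F y z"
    using eventually_mono[OF pos coarse_mass_add_ge[OF assms]] by simp
qed

text \<open>The base point l may lie before, between or after x and y. Additivity of the mass makes
  it cancel in each position.\<close>

lemma staircase_diff:
  assumes "x \<le> y"
  shows "staircase \<alpha> F l y - staircase \<alpha> F l x = mass \<alpha> F x y"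
  using assms mass_add[of l x y] mass_add[of x l y] mass_add[of x y l]
  by (auto simp: staircase_def)

lemma staircase_mono: "x \<le> y \<Longrightarrow> staircase \<alpha> F l x \<le> staircase \<alpha> F l y"
  using staircase_diff[of x y l] mass_nonneg[of x y] by simp

lemma staircase_gap: "x \<le> y \<Longrightarrow> F \<inter> {x..y} = {} \<Longrightarrow> staircase \<alpha> F l x = staircase \<alpha> F l y"
  using staircase_diff[of x y l] mass_gap[of x y] by simp

section \<open>The integral\<close>

text \<open>If [x, y] misses F, both sides are 0 because S is constant there. Hence A and B need
  comparing only on cells that meet F, and the default value of \<open>sup_on\<close> and
  \<open>inf_on\<close> does no harm.\<close>

lemma staircase_weight_mono:
  assumes "x \<le> y" "F \<inter> {x..y} \<noteq> {} \<Longrightarrow> A \<le> B"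
  shows "A * (staircase \<alpha> F l y - staircase \<alpha> F l x) \<le> B * (staircase \<alpha> F l y - staircase \<alpha> F l x)"
  using assms staircase_mono[of x y l] staircase_gap[of x y l]
  by (cases "F \<inter> {x..y} = {}") (auto intro: mult_right_mono)

text \<open>Both pieces are compared with the supremum over [x, z], whose weights add up to the
  increment of S over [x, z].\<close>

lemma superadditive_upper:
  assumes bdd: "bounded (h ` (F \<inter> {c..d}))"
  shows "superadditive_on c d (\<lambda>u v. sup_on F h {u..v} * (staircase \<alpha> F l v - staircase \<alpha> F l u))"
  unfolding superadditive_on_def
proof (intro allI impI)
  fix x y z assume xyz: "c \<le> x" "x \<le> y" "y \<le> z" "z \<le> d"
  have sup: "sup_on F h {u..v} \<le> sup_on F h {x..z}"
    if "x \<le> u" "v \<le> z" "F \<inter> {u..v} \<noteq> {}" for u v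
  proof (rule sup_on_least[OF that(3)])
    fix t assume "t \<in> F \<inter> {u..v}"
    then have "t \<in> F \<inter> {x..z}" using that by auto
    then show "h t \<le> sup_on F h {x..z}"
      by (rule sup_on_upper[OF bounded_image_subinterval[OF bdd xyz(1,4)]])
  qed
  have "sup_on F h {x..y} * (staircase \<alpha> F l y - staircase \<alpha> F l x)
      \<le> sup_on F h {x..z} * (staircase \<alpha> F l y - staircase \<alpha> F l x)"
    using staircase_weight_mono[OF xyz(2) sup[OF order_refl xyz(3)]] .
  moreover have "sup_on F h {y..z} * (staircase \<alpha> F l z - staircase \<alpha> F l y)
      \<le> sup_on F h {x..z} * (staircase \<alpha> F l z - staircase \<alpha> F l y)"
    using staircase_weight_mono[OF xyz(3) sup[OF xyz(2) order_refl]] .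
  moreover have "sup_on F h {x..z} * (staircase \<alpha> F l y - staircase \<alpha> F l x)
      + sup_on F h {x..z} * (staircase \<alpha> F l z - staircase \<alpha> F l y)
      = sup_on F h {x..z} * (staircase \<alpha> F l z - staircase \<alpha> F l x)"
    by (simp flip: distrib_left)
  ultimately show "sup_on F h {x..y} * (staircase \<alpha> F l y - staircase \<alpha> F l x)
      + sup_on F h {y..z} * (staircase \<alpha> F l z - staircase \<alpha> F l y)
      \<le> sup_on F h {x..z} * (staircase \<alpha> F l z - staircase \<alpha> F l x)"
    by linarith
qed

lemma upper_sum_le:
  assumes "subdivision c d m p"
    and "\<And>u v. c \<le> u \<Longrightarrow> v \<le> d \<Longrightarrow> F \<inter> {u..v} \<noteq> {} \<Longrightarrow> sup_on F h {u..v} \<le> C u v"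
  shows "upper_sum \<alpha> F l h m p
    \<le> (\<Sum>i<m. C (p i) (p (Suc i)) * (staircase \<alpha> F l (p (Suc i)) - staircase \<alpha> F l (p i)))"
  unfolding upper_sum_def
proof (rule sum_mono)
  fix i assume "i \<in> {..<m}"
  then have i: "c \<le> p i" "p i \<le> p (Suc i)" "p (Suc i) \<le> d"
    using subdivision_bounds[OF assms(1)] by auto
  show "sup_on F h {p i..p (Suc i)} * (staircase \<alpha> F l (p (Suc i)) - staircase \<alpha> F l (p i))
    \<le> C (p i) (p (Suc i)) * (staircase \<alpha> F l (p (Suc i)) - staircase \<alpha> F l (p i))"
    using i(2) assms(2)[OF i(1,3)] by (rule staircase_weight_mono)
qed

lemma lower_le_upper_same:
  assumes "subdivision c d m p" "bounded (h ` (F \<inter> {c..d}))"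
  shows "lower_sum \<alpha> F l h m p \<le> upper_sum \<alpha> F l h m p"
  unfolding lower_sum_def upper_sum_def
proof (rule sum_mono, rule staircase_weight_mono)
  fix i assume "i \<in> {..<m}"
  then have i: "c \<le> p i" "p i \<le> p (Suc i)" "p (Suc i) \<le> d"
    using subdivision_bounds[OF assms(1)] by auto
  show "p i \<le> p (Suc i)" by (rule i)
  assume "F \<inter> {p i..p (Suc i)} \<noteq> {}"
  then obtain x where x: "x \<in> F \<inter> {p i..p (Suc i)}" by blast
  have b: "bounded (h ` (F \<inter> {p i..p (Suc i)}))"
    using bounded_image_subinterval assms(2) i by blast
  have "inf_on F h {p i..p (Suc i)} \<le> h x"
    using x by (auto simp: inf_on_def intro!: cInf_lower bounded_imp_bdd_below b)
  also have "\<dots> \<le> sup_on F h {p i..p (Suc i)}" using x b by (rule sup_on_upper[rotated])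
  finally show "inf_on F h {p i..p (Suc i)} \<le> sup_on F h {p i..p (Suc i)}" .
qed

text \<open>The refinement is independent of h, so it can be used simultaneously for h and - h, and
  for two different integrands.\<close>

lemma upper_sums_common_refinement:
  assumes "subdivision c d m p" "subdivision c d k q"
  obtains n r where "subdivision c d n r"
    "\<And>h. bounded (h ` (F \<inter> {c..d})) \<Longrightarrow> upper_sum \<alpha> F l h n r \<le> upper_sum \<alpha> F l h m p"
    "\<And>h. bounded (h ` (F \<inter> {c..d})) \<Longrightarrow> upper_sum \<alpha> F l h n r \<le> upper_sum \<alpha> F l h k q"
proof -
  obtain n r where "subdivision c d n r" and "\<And>\<phi>. superadditive_on c d \<phi> \<Longrightarrow>
      interval_sum \<phi> n r \<le> interval_sum \<phi> m p \<and> interval_sum \<phi> n r \<le> interval_sum \<phi> k q"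
    using common_refinement[OF assms] by blast
  from that[OF this(1)] this(2)[OF superadditive_upper] show thesis
    unfolding upper_sum_eq by simp
qed

text \<open>On a common refinement the two sums compare cell by cell. Refinement raises the lower
  sum because it lowers the upper sum of - h.\<close>

lemma lower_le_upper:
  assumes "subdivision c d m p" "subdivision c d k q" and bdd: "bounded (h ` (F \<inter> {c..d}))"
  shows "lower_sum \<alpha> F l h m p \<le> upper_sum \<alpha> F l h k q"
proof -
  obtain n r where r: "subdivision c d n r"
    "\<And>h. bounded (h ` (F \<inter> {c..d})) \<Longrightarrow> upper_sum \<alpha> F l h n r \<le> upper_sum \<alpha> F l h m p"
    "\<And>h. bounded (h ` (F \<inter> {c..d})) \<Longrightarrow> upper_sum \<alpha> F l h n r \<le> upper_sum \<alpha> F l h k q"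
    using upper_sums_common_refinement[OF assms(1,2)] by blast
  show ?thesis
    using lower_le_upper_same[OF r(1) bdd, of l] r(2)[OF bounded_image_minus[OF bdd]] r(3)[OF bdd]
    unfolding lower_sum_eq by linarith
qed

text \<open>One subdivision approximates v from both sides, and the lower side is written with - h.
  Linearity thus reduces to upper estimates of upper sums. The opposite bounds, that v lies below
  all upper and above all lower sums, follow from \<open>lower_le_upper\<close>.\<close>

lemma has_F_integral_iff:
  "has_F_integral \<alpha> F l h c d v \<longleftrightarrow> c \<le> d \<and> bounded (h ` (F \<inter> {c..d})) \<and>
    (\<forall>\<epsilon>>0. \<exists>m p. subdivision c d m p \<and>
       upper_sum \<alpha> F l h m p < v + \<epsilon> \<and> upper_sum \<alpha> F l (\<lambda>x. - h x) m p < - v + \<epsilon>)"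
  (is "?L \<longleftrightarrow> ?R")
proof
  let ?U = "{upper_sum \<alpha> F l h m p | m p. subdivision c d m p}"
  let ?W = "{lower_sum \<alpha> F l h m p | m p. subdivision c d m p}"
  {
    assume L: ?L
    then have cd: "c \<le> d" and bdd: "bounded (h ` (F \<inter> {c..d}))" and v: "Inf ?U = v" "Sup ?W = v"
      by (auto simp: has_F_integral_def)
    \<comment> \<open>The mesh 1 is arbitrary: some subdivision is needed, since near-optimal
      members of \<open>?U\<close> and \<open>?W\<close> exist only when these sets are
      nonempty.\<close>
    obtain m0 p0 where "subdivision c d m0 p0"
      using fine_subdivision_exists[OF cd zero_less_one] unfolding fine_subdivision_def by metis
    then have ne: "?U \<noteq> {}" "?W \<noteq> {}" by blast+
    show ?R
    proof (intro conjI cd bdd allI impI)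
      fix \<epsilon> :: real assume "0 < \<epsilon>"
      then have "Inf ?U < v + \<epsilon>" "v - \<epsilon> < Sup ?W" using v by simp_all
      then obtain m p k q where pq: "subdivision c d m p" "upper_sum \<alpha> F l h m p < v + \<epsilon>"
          "subdivision c d k q" "v - \<epsilon> < lower_sum \<alpha> F l h k q"
        using cInf_lessD[OF ne(1)] less_cSupD[OF ne(2)] by blast
      \<comment> \<open>The infimum and the supremum are approached along different subdivisions; a
        common refinement is good for both.\<close>
      obtain n r where r: "subdivision c d n r"
        "\<And>h. bounded (h ` (F \<inter> {c..d})) \<Longrightarrow> upper_sum \<alpha> F l h n r \<le> upper_sum \<alpha> F l h m p"
        "\<And>h. bounded (h ` (F \<inter> {c..d})) \<Longrightarrow> upper_sum \<alpha> F l h n r \<le> upper_sum \<alpha> F l h k q"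
        using upper_sums_common_refinement[OF pq(1,3)] by blast
      have "upper_sum \<alpha> F l h n r < v + \<epsilon>" "upper_sum \<alpha> F l (\<lambda>x. - h x) n r < - v + \<epsilon>"
        using r(2)[OF bdd] r(3)[OF bounded_image_minus[OF bdd]] pq unfolding lower_sum_eq by linarith+
      then show "\<exists>m p. subdivision c d m p \<and>
          upper_sum \<alpha> F l h m p < v + \<epsilon> \<and> upper_sum \<alpha> F l (\<lambda>x. - h x) m p < - v + \<epsilon>"
        using r(1) by blast
    qed
  next
    assume R: ?R
    then have bdd: "bounded (h ` (F \<inter> {c..d}))" by blast
    have R': "\<exists>m p. subdivision c d m p \<and> upper_sum \<alpha> F l h m p < v + \<epsilon> \<and>
        v - \<epsilon> < lower_sum \<alpha> F l h m p" if "0 < \<epsilon>" for \<epsilon>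
      using R that unfolding lower_sum_eq by (metis minus_diff_eq neg_less_iff_less uminus_add_conv_diff)
    \<comment> \<open>Some lower sum comes within \<epsilon> of v, and no upper sum lies below
      it.\<close>
    have lower: "v \<le> upper_sum \<alpha> F l h m p" if p: "subdivision c d m p" for m p
    proof (rule field_le_epsilon)
      fix \<epsilon> :: real assume "0 < \<epsilon>"
      then obtain k q where "subdivision c d k q" "v - \<epsilon> < lower_sum \<alpha> F l h k q" using R' by blast
      with lower_le_upper[OF this(1) p bdd, of l] show "v \<le> upper_sum \<alpha> F l h m p + \<epsilon>" by linarith
    qed
    have upper: "lower_sum \<alpha> F l h m p \<le> v" if p: "subdivision c d m p" for m p
    proof (rule field_le_epsilon)
      fix \<epsilon> :: real assume "0 < \<epsilon>"
      then obtain k q where "subdivision c d k q" "upper_sum \<alpha> F l h k q < v + \<epsilon>" using R' by blast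
      with lower_le_upper[OF p this(1) bdd, of l] show "lower_sum \<alpha> F l h m p \<le> v + \<epsilon>" by linarith
    qed
    have "Inf ?U = v"
    proof (rule cInf_eq)
      fix w assume w: "\<And>u. u \<in> ?U \<Longrightarrow> w \<le> u"
      show "w \<le> v"
      proof (rule field_le_epsilon)
        fix \<epsilon> :: real assume "0 < \<epsilon>"
        then show "w \<le> v + \<epsilon>" using R' w by force
      qed
    qed (use lower in blast)
    moreover have "Sup ?W = v"
    proof (rule cSup_eq)
      fix w assume w: "\<And>u. u \<in> ?W \<Longrightarrow> u \<le> w"
      show "v \<le> w"
      proof (rule field_le_epsilon)
        fix \<epsilon> :: real assume "0 < \<epsilon>"
        then obtain m p where "subdivision c d m p" "v - \<epsilon> < lower_sum \<alpha> F l h m p" using R' by blast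
        with w[of "lower_sum \<alpha> F l h m p"] show "v \<le> w + \<epsilon>" by fastforce
      qed
    qed (use upper in blast)
    ultimately show ?L using R by (simp add: has_F_integral_def)
  }
qed

section \<open>Linearity of the integral over a compact interval\<close>

lemma upper_sum_add_le:
  assumes "subdivision c d m p" "bounded (h ` (F \<inter> {c..d}))" "bounded (k ` (F \<inter> {c..d}))"
  shows "upper_sum \<alpha> F l (\<lambda>x. h x + k x) m p \<le> upper_sum \<alpha> F l h m p + upper_sum \<alpha> F l k m p"
proof -
  have "sup_on F (\<lambda>x. h x + k x) {u..v} \<le> sup_on F h {u..v} + sup_on F k {u..v}"
    if "c \<le> u" "v \<le> d" "F \<inter> {u..v} \<noteq> {}" for u v
    using that bounded_image_subinterval[OF assms(2) that(1,2)]
      bounded_image_subinterval[OF assms(3) that(1,2)]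
    by (intro sup_on_least add_mono sup_on_upper) simp_all
  then have "upper_sum \<alpha> F l (\<lambda>x. h x + k x) m p
      \<le> (\<Sum>i<m. (sup_on F h {p i..p (Suc i)} + sup_on F k {p i..p (Suc i)})
            * (staircase \<alpha> F l (p (Suc i)) - staircase \<alpha> F l (p i)))"
    by (rule upper_sum_le[OF assms(1)])
  also have "\<dots> = upper_sum \<alpha> F l h m p + upper_sum \<alpha> F l k m p"
    by (simp only: upper_sum_def distrib_right flip: sum.distrib)
  finally show ?thesis .
qed

text \<open>The one-sided estimate suffices, since \<open>has_F_integral_iff\<close> bounds upper
  sums only from above; it is applied to h and to - h.\<close>

lemma upper_sum_scale_le:
  assumes "subdivision c d m p" "bounded (h ` (F \<inter> {c..d}))" "0 \<le> C"
  shows "upper_sum \<alpha> F l (\<lambda>x. C * h x) m p \<le> C * upper_sum \<alpha> F l h m p"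
proof -
  have "sup_on F (\<lambda>x. C * h x) {u..v} \<le> C * sup_on F h {u..v}"
    if "c \<le> u" "v \<le> d" "F \<inter> {u..v} \<noteq> {}" for u v
    using that assms(3) bounded_image_subinterval[OF assms(2) that(1,2)]
    by (intro sup_on_least mult_left_mono sup_on_upper) simp_all
  from upper_sum_le[OF assms(1) this, where l = l] show ?thesis
    by (simp add: upper_sum_def sum_distrib_left algebra_simps)
qed

lemma has_F_integral_add:
  assumes "has_F_integral \<alpha> F l h c d v" "has_F_integral \<alpha> F l k c d w"
  shows "has_F_integral \<alpha> F l (\<lambda>x. h x + k x) c d (v + w)"
proof -
  have bdd: "bounded (h ` (F \<inter> {c..d}))" "bounded (k ` (F \<inter> {c..d}))" and cd: "c \<le> d"
    using assms by (auto simp: has_F_integral_def)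
  show ?thesis unfolding has_F_integral_iff
  proof (intro conjI cd allI impI)
    show "bounded ((\<lambda>x. h x + k x) ` (F \<inter> {c..d}))" using bdd by (rule bounded_plus_comp)
    fix \<epsilon> :: real assume "0 < \<epsilon>"
    then have "0 < \<epsilon> / 2" by simp
    then obtain m p n q where p: "subdivision c d m p" "upper_sum \<alpha> F l h m p < v + \<epsilon> / 2"
        "upper_sum \<alpha> F l (\<lambda>x. - h x) m p < - v + \<epsilon> / 2"
      and q: "subdivision c d n q" "upper_sum \<alpha> F l k n q < w + \<epsilon> / 2"
        "upper_sum \<alpha> F l (\<lambda>x. - k x) n q < - w + \<epsilon> / 2"
      using assms unfolding has_F_integral_iff by meson
    obtain j r where r: "subdivision c d j r"
      "\<And>h. bounded (h ` (F \<inter> {c..d})) \<Longrightarrow> upper_sum \<alpha> F l h j r \<le> upper_sum \<alpha> F l h m p"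
      "\<And>h. bounded (h ` (F \<inter> {c..d})) \<Longrightarrow> upper_sum \<alpha> F l h j r \<le> upper_sum \<alpha> F l h n q"
      using upper_sums_common_refinement[OF p(1) q(1)] by blast
    \<comment> \<open>The same refinement r is used for - h and - k, which takes care of the lower
      sums.\<close>
    note bdd' = bdd[THEN bounded_image_minus]
    have "upper_sum \<alpha> F l (\<lambda>x. h x + k x) j r < v + w + \<epsilon>"
      using upper_sum_add_le[OF r(1) bdd, of l] r(2)[OF bdd(1)] r(3)[OF bdd(2)] p(2) q(2) by linarith
    moreover have "upper_sum \<alpha> F l (\<lambda>x. - (h x + k x)) j r < - (v + w) + \<epsilon>"
      using upper_sum_add_le[OF r(1) bdd', of l] r(2)[OF bdd'(1)] r(3)[OF bdd'(2)] p(3) q(3) by simp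
    ultimately show "\<exists>m p. subdivision c d m p \<and> upper_sum \<alpha> F l (\<lambda>x. h x + k x) m p < v + w + \<epsilon> \<and>
        upper_sum \<alpha> F l (\<lambda>x. - (h x + k x)) m p < - (v + w) + \<epsilon>" using r(1) by blast
  qed
qed

text \<open>Replacing h, v by - h, - v merely exchanges the two inequalities of the
  criterion.\<close>

lemma has_F_integral_minus:
  "has_F_integral \<alpha> F l h c d v \<Longrightarrow> has_F_integral \<alpha> F l (\<lambda>x. - h x) c d (- v)"
  unfolding has_F_integral_iff minus_minus by (blast intro: bounded_image_minus)

lemma has_F_integral_scale_nonneg:
  assumes "has_F_integral \<alpha> F l h c d v" "0 \<le> C"
  shows "has_F_integral \<alpha> F l (\<lambda>x. C * h x) c d (C * v)"
proof -
  have bdd: "bounded (h ` (F \<inter> {c..d}))" and cd: "c \<le> d"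
    using assms by (auto simp: has_F_integral_def)
  show ?thesis unfolding has_F_integral_iff
  proof (intro conjI cd allI impI)
    show "bounded ((\<lambda>x. C * h x) ` (F \<inter> {c..d}))" using bounded_scaleR_comp[OF bdd, of C] by simp
    fix \<epsilon> :: real assume "0 < \<epsilon>"
    \<comment> \<open>Dividing by C + 1 instead of C admits C = 0 and keeps C * \<eta> < \<epsilon>
      strict.\<close>
    define \<eta> where "\<eta> = \<epsilon> / (C + 1)"
    have \<eta>: "0 < \<eta>" "C * \<eta> < \<epsilon>" using \<open>0 < \<epsilon>\<close> assms(2) by (simp_all add: \<eta>_def field_simps)
    obtain m p where p: "subdivision c d m p" "upper_sum \<alpha> F l h m p < v + \<eta>"
        "upper_sum \<alpha> F l (\<lambda>x. - h x) m p < - v + \<eta>"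
      using assms(1) \<eta>(1) unfolding has_F_integral_iff by meson
    have "C * upper_sum \<alpha> F l h m p \<le> C * (v + \<eta>)"
      "C * upper_sum \<alpha> F l (\<lambda>x. - h x) m p \<le> C * (- v + \<eta>)"
      using p assms(2) by (simp_all add: mult_left_mono)
    then have "upper_sum \<alpha> F l (\<lambda>x. C * h x) m p < C * v + \<epsilon>"
      "upper_sum \<alpha> F l (\<lambda>x. - (C * h x)) m p < - (C * v) + \<epsilon>"
      using upper_sum_scale_le[OF p(1) bdd assms(2), of l]
        upper_sum_scale_le[OF p(1) bounded_image_minus[OF bdd] assms(2), of l] \<eta>(2)
      by (simp_all add: algebra_simps)
    then show "\<exists>m p. subdivision c d m p \<and> upper_sum \<alpha> F l (\<lambda>x. C * h x) m p < C * v + \<epsilon> \<and>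
        upper_sum \<alpha> F l (\<lambda>x. - (C * h x)) m p < - (C * v) + \<epsilon>" using p(1) by blast
  qed
qed

lemma has_F_integral_scale:
  assumes "has_F_integral \<alpha> F l h c d v"
  shows "has_F_integral \<alpha> F l (\<lambda>x. C * h x) c d (C * v)"
proof (cases "0 \<le> C")
  case False
  \<comment> \<open>A negative factor is written as C * h = (- C) * (- h) with - C > 0.\<close>
  then have "has_F_integral \<alpha> F l (\<lambda>x. - C * - h x) c d (- C * - v)"
    by (intro has_F_integral_scale_nonneg has_F_integral_minus assms) simp
  then show ?thesis by simp
qed (rule has_F_integral_scale_nonneg[OF assms])

end

end

section \<open>The improper integral up to the point where the staircase stops growing\<close>

lemma growth_end_ge:
  assumes "c \<le> d"
  shows "c \<le> growth_end \<alpha> F l c d"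
  unfolding growth_end_def
  by (rule cSup_upper) (use assms in \<open>auto intro: bdd_aboveI[of _ d]\<close>)

lemma has_improper_F_integralD:
  assumes "has_improper_F_integral \<alpha> F l h c d v" "growth_end \<alpha> F l c d \<noteq> c"
  shows "\<exists>J. (\<forall>u\<in>{c..<growth_end \<alpha> F l c d}. has_F_integral \<alpha> F l h c u (J u)) \<and>
    (J \<longlongrightarrow> v) (at_left (growth_end \<alpha> F l c d))"
  using assms by (simp add: has_improper_F_integral_def Let_def)

text \<open>The point \<open>growth_end\<close> depends on the staircase and the interval alone, so
  both integrals are improper at the same point, and their values over [c, u] can be combined for
  every u before the limit is taken. If that point is c, all values are 0.\<close>

lemma has_improper_F_integral_linear:
  assumes "0 < \<alpha>" "finite_mass \<alpha> F"
    and "has_improper_F_integral \<alpha> F l h c d v" "has_improper_F_integral \<alpha> F l k c d w"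
  shows "has_improper_F_integral \<alpha> F l (\<lambda>x. A * h x + B * k x) c d (A * v + B * w)"
proof (cases "growth_end \<alpha> F l c d = c")
  case True
  then show ?thesis using assms(3,4) by (simp add: has_improper_F_integral_def)
next
  case False
  let ?e = "growth_end \<alpha> F l c d"
  obtain J where J: "\<And>u. u \<in> {c..<?e} \<Longrightarrow> has_F_integral \<alpha> F l h c u (J u)" "(J \<longlongrightarrow> v) (at_left ?e)"
    using has_improper_F_integralD[OF assms(3) False] by blast
  obtain K where K: "\<And>u. u \<in> {c..<?e} \<Longrightarrow> has_F_integral \<alpha> F l k c u (K u)" "(K \<longlongrightarrow> w) (at_left ?e)"
    using has_improper_F_integralD[OF assms(4) False] by blast
  have "\<exists>L. (\<forall>u\<in>{c..<?e}. has_F_integral \<alpha> F l (\<lambda>x. A * h x + B * k x) c u (L u)) \<and>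
      (L \<longlongrightarrow> A * v + B * w) (at_left ?e)"
  proof (intro exI conjI ballI)
    show "((\<lambda>u. A * J u + B * K u) \<longlongrightarrow> A * v + B * w) (at_left ?e)"
      by (intro tendsto_add tendsto_mult_left J(2) K(2))
  next
    fix u assume u: "u \<in> {c..<?e}"
    show "has_F_integral \<alpha> F l (\<lambda>x. A * h x + B * k x) c u (A * J u + B * K u)"
      by (rule has_F_integral_add[OF assms(1,2) has_F_integral_scale[OF assms(1,2) J(1)[OF u]]
          has_F_integral_scale[OF assms(1,2) K(1)[OF u]]])
  qed
  then show ?thesis
    using assms(3) False by (simp add: has_improper_F_integral_def Let_def)
qed

text \<open>Over each [c, u] the value is fixed as the infimum of the upper sums, so two candidate
  functions J and K agree left of \<open>growth_end\<close> and have the same limit. This evaluates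
  the \<open>THE\<close> in the fractal time derivative.\<close>

lemma has_improper_F_integral_unique:
  assumes "has_improper_F_integral \<alpha> F l h c d v" "has_improper_F_integral \<alpha> F l h c d w"
  shows "v = w"
proof (cases "growth_end \<alpha> F l c d = c")
  case True
  then show ?thesis using assms by (simp add: has_improper_F_integral_def)
next
  case False
  let ?e = "growth_end \<alpha> F l c d"
  \<comment> \<open>This makes (c, e) a left neighbourhood of e, on which J and K can be
    compared.\<close>
  have "c < ?e"
    using growth_end_ge[of c d \<alpha> F l] False assms(1) by (simp add: has_improper_F_integral_def)
  obtain J where J: "\<And>u. u \<in> {c..<?e} \<Longrightarrow> has_F_integral \<alpha> F l h c u (J u)" "(J \<longlongrightarrow> v) (at_left ?e)"
    using has_improper_F_integralD[OF assms(1) False] by blast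
  obtain K where K: "\<And>u. u \<in> {c..<?e} \<Longrightarrow> has_F_integral \<alpha> F l h c u (K u)" "(K \<longlongrightarrow> w) (at_left ?e)"
    using has_improper_F_integralD[OF assms(2) False] by blast
  have "J u = K u" if "u \<in> {c<..<?e}" for u
    using J(1)[of u] K(1)[of u] that by (simp add: has_F_integral_def)
  then have "\<forall>\<^sub>F u in at_left ?e. J u = K u"
    using \<open>c < ?e\<close> by (rule eventually_at_leftI)
  then have "(K \<longlongrightarrow> v) (at_left ?e)" using J(2) by (rule Lim_transform_eventually[rotated])
  then show ?thesis using K(2) by (rule tendsto_unique[OF trivial_limit_at_left_real])
qed

lemma has_improper_F_integral_the:
  "has_improper_F_integral \<alpha> F l h c d v \<Longrightarrow> (THE v. has_improper_F_integral \<alpha> F l h c d v) = v"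
  by (rule the_equality) (auto dest: has_improper_F_integral_unique)

section \<open>The derivative\<close>

text \<open>An identity for every y: where the denominator vanishes, both sides are 0 by the
  convention for division by 0.\<close>

lemma F_quotient_linear:
  "F_quotient \<alpha> F l (\<lambda>x. A * h x + B * k x) x =
     (\<lambda>y. A * F_quotient \<alpha> F l h x y + B * F_quotient \<alpha> F l k x y)"
  by (rule ext) (simp add: F_quotient_def algebra_simps add_divide_distrib diff_divide_distrib)

lemma F_differentiable_linear:
  assumes "F_differentiable \<alpha> F l I h x" "F_differentiable \<alpha> F l I k x"
  shows "F_differentiable \<alpha> F l I (\<lambda>x. A * h x + B * k x) x"
proof -
  obtain D E where "(F_quotient \<alpha> F l h x \<longlongrightarrow> D) (at x within (F \<inter> I))"
    "(F_quotient \<alpha> F l k x \<longlongrightarrow> E) (at x within (F \<inter> I))"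
    using assms by (auto simp: F_differentiable_def)
  then have "(F_quotient \<alpha> F l (\<lambda>x. A * h x + B * k x) x \<longlongrightarrow> A * D + B * E) (at x within (F \<inter> I))"
    unfolding F_quotient_linear by (intro tendsto_intros)
  then show ?thesis using assms(1) by (auto simp: F_differentiable_def)
qed

text \<open>That x is a limit point of F \<inter> I makes the filter nontrivial, so the limit is
  unique and \<open>Lim\<close> returns it.\<close>

lemma F_deriv_tendsto:
  assumes "F_differentiable \<alpha> F l I h x" "x \<in> F \<inter> I"
  shows "(F_quotient \<alpha> F l h x \<longlongrightarrow> F_deriv \<alpha> F l I h x) (at x within (F \<inter> I))"
proof -
  have "at x within (F \<inter> I) \<noteq> bot"
    using assms(1) by (simp add: F_differentiable_def trivial_limit_within)
  then show ?thesis
    using assms tendsto_Lim by (fastforce simp: F_differentiable_def F_deriv_def)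
qed

text \<open>An equality of total functions, with 0 on both sides outside F \<inter> I, so that it
  can be rewritten under the next derivative.\<close>

lemma F_deriv_linear:
  assumes "\<forall>x\<in>F \<inter> I. F_differentiable \<alpha> F l I h x" "\<forall>x\<in>F \<inter> I. F_differentiable \<alpha> F l I k x"
  shows "F_deriv \<alpha> F l I (\<lambda>x. A * h x + B * k x) =
    (\<lambda>x. A * F_deriv \<alpha> F l I h x + B * F_deriv \<alpha> F l I k x)"
proof
  fix x
  show "F_deriv \<alpha> F l I (\<lambda>x. A * h x + B * k x) x =
    A * F_deriv \<alpha> F l I h x + B * F_deriv \<alpha> F l I k x"
  proof (cases "x \<in> F \<inter> I")
    case True
    have nt: "at x within (F \<inter> I) \<noteq> bot"
      using assms(1) True by (simp add: F_differentiable_def trivial_limit_within)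
    have "(F_quotient \<alpha> F l (\<lambda>x. A * h x + B * k x) x \<longlongrightarrow>
        A * F_deriv \<alpha> F l I h x + B * F_deriv \<alpha> F l I k x) (at x within (F \<inter> I))"
      unfolding F_quotient_linear using assms True by (intro tendsto_intros F_deriv_tendsto) auto
    then show ?thesis using tendsto_Lim[OF nt] True by (simp add: F_deriv_def)
  qed (auto simp: F_deriv_def)
qed

text \<open>Passing from j to j + 1 needs differentiability of the j-th iterates, which
  \<open>C_F\<close> grants for j < n; hence the range j \<le> n.\<close>

lemma F_deriv_funpow_linear:
  assumes "h \<in> C_F \<alpha> F l n a b" "k \<in> C_F \<alpha> F l n a b" "j \<le> n"
  shows "(F_deriv \<alpha> F l {a..b} ^^ j) (\<lambda>x. A * h x + B * k x) =
    (\<lambda>x. A * (F_deriv \<alpha> F l {a..b} ^^ j) h x + B * (F_deriv \<alpha> F l {a..b} ^^ j) k x)"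
  using assms(3)
proof (induction j)
  case (Suc j)
  then show ?case using assms(1,2) by (simp add: C_F_def F_deriv_linear)
qed simp

lemma C_F_linear:
  assumes "h \<in> C_F \<alpha> F l n a b" "k \<in> C_F \<alpha> F l n a b"
  shows "(\<lambda>x. A * h x + B * k x) \<in> C_F \<alpha> F l n a b"
  using assms F_deriv_funpow_linear[OF assms]
  by (auto simp: C_F_def intro!: F_differentiable_linear)

text \<open>Membership in the class and existence of the derivative are part of the conclusion, so
  that the equation is between genuine integrals and not between unspecified \<open>THE\<close>
  values.\<close>

theorem theorem3p4:
  fixes \<alpha> l a b \<gamma> t l1 l2 :: real and F :: "real set" and n :: nat and f g :: "real \<Rightarrow> real"
  assumes "0 < \<alpha>" and "\<alpha> \<le> 1" and "finite_mass \<alpha> F"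
    and "a < b" and "0 \<in> {a..b}" and "t \<in> {0..b}"
    and "n \<ge> 1" and "\<gamma> \<in> {real n - 1..<real n}"
    and "(\<lambda>\<tau>. f (staircase \<alpha> F l \<tau>)) \<in> C_F \<alpha> F l n a b"
    and "(\<lambda>\<tau>. g (staircase \<alpha> F l \<tau>)) \<in> C_F \<alpha> F l n a b"
    and "has_frac_time_deriv \<alpha> F l a b n \<gamma> f t"
    and "has_frac_time_deriv \<alpha> F l a b n \<gamma> g t"
  shows "(\<lambda>\<tau>. l1 * f (staircase \<alpha> F l \<tau>) + l2 * g (staircase \<alpha> F l \<tau>)) \<in> C_F \<alpha> F l n a b \<and>
    has_frac_time_deriv \<alpha> F l a b n \<gamma> (\<lambda>s. l1 * f s + l2 * g s) t \<and>
    frac_time_deriv \<alpha> F l a b n \<gamma> (\<lambda>s. l1 * f s + l2 * g s) t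
      = l1 * frac_time_deriv \<alpha> F l a b n \<gamma> f t + l2 * frac_time_deriv \<alpha> F l a b n \<gamma> g t"
proof -
  note \<alpha> = \<open>0 < \<alpha>\<close> and fin = \<open>finite_mass \<alpha> F\<close>
  let ?I = "frac_integrand \<alpha> F l a b n \<gamma>"
  let ?P = "\<lambda>h v. has_improper_F_integral \<alpha> F l (?I h t) 0 t v"
  \<comment> \<open>The power of S(t) - S(\<tau>) is a common divisor, so linearity of the n-th
    iterate passes to the integrand at every \<tau>; where the divisor is 0, both sides are
    0.\<close>
  have integrand: "?I (\<lambda>s. l1 * f s + l2 * g s) t = (\<lambda>\<tau>. l1 * ?I f t \<tau> + l2 * ?I g t \<tau>)"
    by (rule ext)
      (simp add: frac_integrand_def F_deriv_funpow_linear[OF assms(9,10) order_refl] add_divide_distrib)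
  obtain v w where vw: "?P f v" "?P g w" using assms(11,12) by (auto simp: has_frac_time_deriv_def)
  have lin: "?P (\<lambda>s. l1 * f s + l2 * g s) (l1 * v + l2 * w)"
    unfolding integrand by (rule has_improper_F_integral_linear[OF \<alpha> fin vw])
  show ?thesis
    \<comment> \<open>Uniqueness evaluates the three \<open>THE\<close> terms to l1 * v + l2 * w, v
      and w; the common factor then distributes over the sum.\<close>
    using C_F_linear[OF assms(9,10)] lin
    by (auto simp: has_frac_time_deriv_def frac_time_deriv_def add_divide_distrib
        has_improper_F_integral_the[OF lin] vw[THEN has_improper_F_integral_the])
qed

end
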